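(* Let $f:\mathbb{N}\to\mathbb{R}$ be a nonnegative multiplicative function with $f(1)=1$, and let $k\ge2$ be a fixed integer. If for every prime $p$ and all integers $a,b\ge0$ one has $\big(f(p^{a+b})\big)^k\le p^{ka} f(p^{kb})$ (resp. $\big(f(p^{a+b})\big)^k\ge p^{ka} f(p^{kb})$), then $f$ is $k$-sub-homogeneous (resp. $k$-super-homogeneous).
   Context: $\mathbb{N}=\{1,2,3,\dots\}$. $f$ is multiplicative if $f(mn)=f(m)f(n)$ whenever $\gcd(m,n)=1$. $f$ is $k$-sub-homogeneous if $\big(f(mn)\big)^k\le m^k f(n^k)$ for all $m,n\ge1$, and $k$-super-homogeneous if $\big(f(mn)\big)^k\ge m^k f(n^k)$ for all $m,n\ge1$. *)

theory Defs
  imports Complex_Main "HOL-Computational_Algebra.Primes"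
begin

(* Functions on the positive integers are represented as functions on nat; the value at 0 is
   irrelevant, so every quantifier over arguments is restricted to positive numbers. *)

definition multiplicative :: "(nat \<Rightarrow> real) \<Rightarrow> bool" where
  "multiplicative f \<longleftrightarrow> (\<forall>m\<ge>1. \<forall>n\<ge>1. gcd m n = 1 \<longrightarrow> f (m * n) = f m * f n)"

definition sub_homogeneous :: "nat \<Rightarrow> (nat \<Rightarrow> real) \<Rightarrow> bool" where
  "sub_homogeneous k f \<longleftrightarrow> (\<forall>m\<ge>1. \<forall>n\<ge>1. f (m * n) ^ k \<le> real m ^ k * f (n ^ k))"

definition super_homogeneous :: "nat \<Rightarrow> (nat \<Rightarrow> real) \<Rightarrow> bool" where
  "super_homogeneous k f \<longleftrightarrow> (\<forall>m\<ge>1. \<forall>n\<ge>1. f (m * n) ^ k \<ge> real m ^ k * f (n ^ k))"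

end

theory Submission
  imports Defs
begin

(* Over a common finite set of primes, both sides of the inequality factor into the local
   factors bounded by the hypothesis; all of these are nonnegative, so the bounds multiply. *)

text \<open>Write \<open>m\<close> and \<open>n\<close> over the primes dividing either of them,
  with exponents \<open>a p\<close> and \<open>b p\<close>. Then \<open>m * n\<close> has exponents
  \<open>a p + b p\<close> and \<open>n ^ k\<close> has exponents \<open>k * b p\<close>, so by
  multiplicativity the two sides of the global inequality are products of exactly the two sides of
  the local one at \<open>p\<close>, \<open>a p\<close>, \<open>b p\<close>. This is
  \<open>homogeneity_local_factorization\<close>; it rests on
  \<open>multiplicative_prod_prime_powers\<close>, which carries \<open>f\<close> through such
  products, and on \<open>prod_prime_powers_superset\<close>, which permits a common index
  set.\<close>

lemma multiplicative_prod_prime_powers: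
  assumes mult: "multiplicative f" and one: "f 1 = 1"
    and "finite S" and "\<And>p. p \<in> S \<Longrightarrow> prime p"
  shows "f (\<Prod>p\<in>S. p ^ e p) = (\<Prod>p\<in>S. f (p ^ e p))"
  using assms(3,4)
proof (induction S rule: finite_induct)
  \<comment> \<open>The empty product is 1, so this is where \<open>f 1 = 1\<close> enters.\<close>
  case empty
  then show ?case using one by simp
next
  case (insert q S)
  have "coprime (q ^ e q) (\<Prod>p\<in>S. p ^ e p)"
  proof (rule prod_coprime_right)
    fix p assume "p \<in> S"
    then have "coprime q p"
      using insert by (intro primes_coprime) auto
    then show "coprime (q ^ e q) (p ^ e p)" by simp
  qed
  moreover have "q ^ e q \<ge> 1" "(\<Prod>p\<in>S. p ^ e p) \<ge> 1"
    using insert.prems by (auto simp: Suc_le_eq prime_gt_0_nat intro!: prod_pos)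
  ultimately have "f (q ^ e q * (\<Prod>p\<in>S. p ^ e p)) = f (q ^ e q) * f (\<Prod>p\<in>S. p ^ e p)"
    using mult unfolding multiplicative_def by (simp add: coprime_iff_gcd_eq_1)
  then show ?case using insert by simp
qed

text \<open>A prime of \<open>S\<close> not dividing \<open>n\<close> has multiplicity 0 and
  contributes a factor 1. The slack in \<open>S\<close> lets two numbers be factored over the same
  primes.\<close>

lemma prod_prime_powers_superset:
  fixes n :: nat
  assumes "n > 0" "finite S" "prime_factors n \<subseteq> S" "\<And>p. p \<in> S \<Longrightarrow> prime p"
  shows "n = (\<Prod>p\<in>S. p ^ multiplicity p n)"
proof -
  have "n = (\<Prod>p\<in>prime_factors n. p ^ multiplicity p n)"
    using assms(1) by (simp add: prod_prime_factors)
  also have "\<dots> = (\<Prod>p\<in>S. p ^ multiplicity p n)"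
    using assms by (intro prod.mono_neutral_left) (auto simp: prime_factors_multiplicity)
  finally show ?thesis .
qed

text \<open>Only equalities appear here, so the sub- and super-homogeneous cases share one
  factorization and differ only in the direction of the local bound.\<close>

lemma homogeneity_local_factorization:
  fixes m n k :: nat
  assumes mult: "multiplicative f" and one: "f 1 = 1" and "m \<ge> 1" "n \<ge> 1"
  obtains S a b where "\<And>p. p \<in> S \<Longrightarrow> prime p"
    and "f (m * n) ^ k = (\<Prod>p\<in>S. f (p ^ (a p + b p)) ^ k)"
    and "real m ^ k * f (n ^ k) = (\<Prod>p\<in>S. real p ^ (k * a p) * f (p ^ (k * b p)))"
proof -
  \<comment> \<open>A prime dividing only one of \<open>m\<close> and \<open>n\<close> gets exponent
    0 in the other; the local hypothesis covers this, since it allows \<open>a = 0\<close> or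
    \<open>b = 0\<close>.\<close>
  define S where "S = prime_factors m \<union> prime_factors n"
  define a where "a p = multiplicity p m" for p
  define b where "b p = multiplicity p n" for p
  have S: "finite S" "\<And>p. p \<in> S \<Longrightarrow> prime p" unfolding S_def by auto
  have m: "m = (\<Prod>p\<in>S. p ^ a p)" and n: "n = (\<Prod>p\<in>S. p ^ b p)"
    unfolding a_def b_def using assms(3,4) S
    by (auto intro!: prod_prime_powers_superset simp: S_def)
  have mn: "m * n = (\<Prod>p\<in>S. p ^ (a p + b p))"
    by (subst m, subst n) (simp add: power_add prod.distrib)
  have nk: "n ^ k = (\<Prod>p\<in>S. p ^ (k * b p))"
    by (subst n) (simp add: prod_power_distrib mult.commute flip: power_mult)
  have mk: "real m ^ k = (\<Prod>p\<in>S. real p ^ (k * a p))"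
    by (subst m) (simp add: prod_power_distrib mult.commute flip: power_mult)
  note f_prod = multiplicative_prod_prime_powers[OF mult one S]
  show thesis
  proof (rule that[OF S(2)])
    show "f (m * n) ^ k = (\<Prod>p\<in>S. f (p ^ (a p + b p)) ^ k)"
      by (simp only: mn f_prod prod_power_distrib)
    show "real m ^ k * f (n ^ k) = (\<Prod>p\<in>S. real p ^ (k * a p) * f (p ^ (k * b p)))"
      by (simp only: mk nk f_prod prod.distrib)
  qed
qed

theorem theorem9:
  fixes f :: "nat \<Rightarrow> real" and k :: nat
  assumes "\<And>n. n \<ge> 1 \<Longrightarrow> f n \<ge> 0"
    and "multiplicative f"
    and "f 1 = 1"
    and "k \<ge> 2"
  shows "((\<forall>p a b. prime p \<longrightarrow> f (p ^ (a + b)) ^ k \<le> real p ^ (k * a) * f (p ^ (k * b)))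
            \<longrightarrow> sub_homogeneous k f)
       \<and> ((\<forall>p a b. prime p \<longrightarrow> f (p ^ (a + b)) ^ k \<ge> real p ^ (k * a) * f (p ^ (k * b)))
            \<longrightarrow> super_homogeneous k f)"
proof -
  have nonneg: "f (p ^ e) \<ge> 0" if "prime p" for p e
    using that by (intro assms(1)) (simp add: Suc_le_eq prime_gt_0_nat)
  show ?thesis
  proof (intro conjI impI)
    assume local_le:
      "\<forall>p a b. prime p \<longrightarrow> f (p ^ (a + b)) ^ k \<le> real p ^ (k * a) * f (p ^ (k * b))"
    show "sub_homogeneous k f"
      unfolding sub_homogeneous_def
    proof (intro allI impI)
      fix m n :: nat assume "m \<ge> 1" "n \<ge> 1"
      from homogeneity_local_factorization[OF assms(2,3) this, of k]
      obtain S a b where "\<And>p. p \<in> S \<Longrightarrow> prime p"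
        and "f (m * n) ^ k = (\<Prod>p\<in>S. f (p ^ (a p + b p)) ^ k)"
        and "real m ^ k * f (n ^ k) = (\<Prod>p\<in>S. real p ^ (k * a p) * f (p ^ (k * b p)))"
        by blast
      \<comment> \<open>Multiplying inequalities requires the smaller factors to be nonnegative:
        here the powers \<open>f (p ^ (a p + b p)) ^ k\<close>.\<close>
      then show "f (m * n) ^ k \<le> real m ^ k * f (n ^ k)"
        using local_le by (auto intro!: prod_mono nonneg zero_le_power)
    qed
  next
    assume local_ge:
      "\<forall>p a b. prime p \<longrightarrow> f (p ^ (a + b)) ^ k \<ge> real p ^ (k * a) * f (p ^ (k * b))"
    show "super_homogeneous k f"
      unfolding super_homogeneous_def
    proof (intro allI impI)
      fix m n :: nat assume "m \<ge> 1" "n \<ge> 1"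
      from homogeneity_local_factorization[OF assms(2,3) this, of k]
      obtain S a b where "\<And>p. p \<in> S \<Longrightarrow> prime p"
        and "f (m * n) ^ k = (\<Prod>p\<in>S. f (p ^ (a p + b p)) ^ k)"
        and "real m ^ k * f (n ^ k) = (\<Prod>p\<in>S. real p ^ (k * a p) * f (p ^ (k * b p)))"
        by blast
      \<comment> \<open>The smaller factors are now
        \<open>real p ^ (k * a p) * f (p ^ (k * b p))\<close>, nonnegative as products of
        nonnegative terms.\<close>
      then show "f (m * n) ^ k \<ge> real m ^ k * f (n ^ k)"
        using local_ge by (auto intro!: prod_mono nonneg mult_nonneg_nonneg)
    qed
  qed
qed

end
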